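(* Let $\phi\in\mathcal{C}^n(\mathbb{R}^n,\mathbb{R})$ and $h\in\mathcal{C}^n(\mathbb{R}^n,\mathbb{R}^m)$ be (possibly nonconvex) functions such that the Jacobian $J_h(x)\in\mathbb{R}^{m\times n}$ has full rank $m$ for every $x$, and put $G(x)=J_h(x)J_h(x)^\top$. Let $\alpha_i,\beta_i>0$ ($i=1,\dots,m$), $0<p<1$ and $q>1$. Consider the closed-loop system $$\dot x(t)=-\nabla\phi(x(t))-J_h(x(t))^\top\lambda_{\mathrm{FxTS}}(x(t)),$$ with control input $\lambda_{\mathrm{FxTS}}(x)=\lambda_{\mathrm{eq}}(x)+\lambda_{\mathrm{sw}}(x)$, where $$\lambda_{\mathrm{eq}}(x)=-G(x)^{-1}J_h(x)\nabla\phi(x),$$ $$\lambda_{\mathrm{sw}}(x)=G(x)^{-1}\left[\alpha\circ\mathrm{sgn}(h(x))\circ|h(x)|^{p}+\beta\circ\mathrm{sgn}(h(x))\circ|h(x)|^{q}\right].$$ Then the state trajectory reaches the constraint manifold $\mathcal{S}=\{x\in\mathbb{R}^n\mid h(x)=0\}$ in fixed time: there exists $T_c>0$, independent of the initial condition, such that $h(x(t))=0$ for all $t\ge T_c$, and the settling time satisfies $$T_c\le T_{\max}=\frac{2}{\alpha_{\min}(1-p)}+\frac{2}{\beta_{\min}(q-1)},$$ where $\alpha_{\min}=\min_i\alpha_i$ and $\beta_{\min}=\min_i\beta_i$.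
   Context: The system arises from the equality-constrained problem $\min_{x\in\mathbb{R}^n}\phi(x)$ subject to $h(x)=0$. $\mathcal{C}^k$ denotes $k$-times continuously differentiable functions. $J_h(x)$ is the Jacobian with $(i,j)$ entry $\partial h_i(x)/\partial x_j$. All products $\circ$, $\mathrm{sgn}$, absolute values and powers of vectors are taken elementwise: the $i$-th entry of $\alpha\circ\mathrm{sgn}(h)\circ|h|^{p}$ is $\alpha_i\,\mathrm{sgn}(h_i)|h_i|^{p}$, with $\mathrm{sgn}(s)=s/|s|$ for $s\neq0$ (so the entry is $0$ when $h_i=0$), and similarly for $\beta$ and $q$. The trajectory is understood to start at time $t=0$ and to be defined for all $t\ge0$. *)

theory Defs
  imports "HOL-Analysis.Analysis"
begin

(* In finite dimension this is equivalent to continuity of all Frechet derivatives up to order k: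
   the derivative is C^k as an operator-valued map iff each x |-> Df(x) v is C^k. *)
fun Ck :: "nat \<Rightarrow> ('a::euclidean_space \<Rightarrow> 'b::euclidean_space) \<Rightarrow> bool" where
  "Ck 0 f \<longleftrightarrow> continuous_on UNIV f"
| "Ck (Suc k) f \<longleftrightarrow>
     (\<forall>x. f differentiable (at x)) \<and> (\<forall>v. Ck k (\<lambda>x. frechet_derivative f (at x) v))"

definition gradient :: "(real ^ 'n \<Rightarrow> real) \<Rightarrow> real ^ 'n \<Rightarrow> real ^ 'n" where
  "gradient f x = (\<chi> j. frechet_derivative f (at x) (axis j 1))"

lemma gradient_gderiv:
  assumes "f differentiable (at x)"
  shows "GDERIV f x :> gradient f x"
proof -
  let ?D = "frechet_derivative f (at x)"
  have D: "(f has_derivative ?D) (at x)"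
    using assms by (simp add: frechet_derivative_works)
  then have lin: "linear ?D"
    by (rule has_derivative_linear)
  have "?D v = v \<bullet> gradient f x" for v
  proof -
    have "?D v = ?D (\<Sum>j\<in>UNIV. v $ j *\<^sub>R axis j 1)"
      by (simp add: basis_expansion scalar_mult_eq_scaleR[symmetric])
    also have "\<dots> = (\<Sum>j\<in>UNIV. v $ j * ?D (axis j 1))"
      by (simp add: linear_sum[OF lin] linear_cmul[OF lin])
    finally show ?thesis
      by (simp add: inner_vec_def gradient_def)
  qed
  then have "?D = (\<lambda>v. v \<bullet> gradient f x)"
    by blast
  with D show ?thesis
    by (simp add: gderiv_def)
qed

abbreviation Jac :: "(real ^ 'n \<Rightarrow> real ^ 'm) \<Rightarrow> real ^ 'n \<Rightarrow> real ^ 'n ^ 'm" where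
  "Jac h x \<equiv> jacobian h (at x)"

definition Gram :: "(real ^ 'n \<Rightarrow> real ^ 'm) \<Rightarrow> real ^ 'n \<Rightarrow> real ^ 'm ^ 'm" where
  "Gram h x = Jac h x ** transpose (Jac h x)"

definition lambda_eq ::
  "(real ^ 'n \<Rightarrow> real) \<Rightarrow> (real ^ 'n \<Rightarrow> real ^ 'm) \<Rightarrow> real ^ 'n \<Rightarrow> real ^ 'm" where
  "lambda_eq \<phi> h x = - (matrix_inv (Gram h x) *v (Jac h x *v gradient \<phi> x))"

definition lambda_sw ::
  "(real ^ 'n \<Rightarrow> real ^ 'm) \<Rightarrow> real ^ 'm \<Rightarrow> real ^ 'm \<Rightarrow> real \<Rightarrow> real \<Rightarrow> real ^ 'n \<Rightarrow> real ^ 'm" where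
  "lambda_sw h \<alpha> \<beta> p q x = matrix_inv (Gram h x) *v
     (\<chi> i. \<alpha> $ i * sgn (h x $ i) * \<bar>h x $ i\<bar> powr p + \<beta> $ i * sgn (h x $ i) * \<bar>h x $ i\<bar> powr q)"

definition lambda_FxTS ::
  "(real ^ 'n \<Rightarrow> real) \<Rightarrow> (real ^ 'n \<Rightarrow> real ^ 'm) \<Rightarrow> real ^ 'm \<Rightarrow> real ^ 'm \<Rightarrow> real \<Rightarrow> real
     \<Rightarrow> real ^ 'n \<Rightarrow> real ^ 'm" where
  "lambda_FxTS \<phi> h \<alpha> \<beta> p q x = lambda_eq \<phi> h x + lambda_sw h \<alpha> \<beta> p q x"

(* Classical solutions suffice: for p > 0 the switching term is continuous at h = 0,
   so the right-hand side is a continuous vector field. *)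
definition trajectory ::
  "(real ^ 'n \<Rightarrow> real) \<Rightarrow> (real ^ 'n \<Rightarrow> real ^ 'm) \<Rightarrow> real ^ 'm \<Rightarrow> real ^ 'm \<Rightarrow> real \<Rightarrow> real
     \<Rightarrow> (real \<Rightarrow> real ^ 'n) \<Rightarrow> bool" where
  "trajectory \<phi> h \<alpha> \<beta> p q x \<longleftrightarrow>
     (\<forall>t\<ge>0. (x has_vector_derivative
        (- gradient \<phi> (x t) - transpose (Jac h (x t)) *v lambda_FxTS \<phi> h \<alpha> \<beta> p q (x t)))
        (at t within {0..}))"

end

theory Submission
  imports Defs
begin

text \<open>
  The equivalent control \<^const>\<open>lambda_eq\<close> cancels the drift of the constraint and the switching
  control prescribes what is left: along a trajectory,
  \<open>d/dt h(x(t)) = J x' = - J \<nabla>\<phi> - G (\<lambda>\<^sub>e\<^sub>q + \<lambda>\<^sub>s\<^sub>w)\<close>, and since full row rank of \<open>J\<close> makes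
  \<open>G = J J\<^sup>T\<close> invertible, everything cancels except
  \<open>s\<^sub>i' = - \<alpha>\<^sub>i sgn(s\<^sub>i) |s\<^sub>i|\<^sup>p - \<beta>\<^sub>i sgn(s\<^sub>i) |s\<^sub>i|\<^sup>q\<close> for \<open>s = h \<circ> x\<close>
  (lemma \<open>constraint_dynamics\<close>).  The components are thus decoupled, and the objective has vanished
  from the problem.

  Each \<open>V = s\<^sub>i\<^sup>2\<close> satisfies \<open>V' = - 2 \<alpha>\<^sub>i V\<^bsup>(1+p)/2\<^esup> - 2 \<beta>\<^sub>i V\<^bsup>(1+q)/2\<^esup>\<close>, one exponent below 1
  and one above.  The term with the large exponent brings \<open>V\<close> from any initial value below 1 in a
  time that does not depend on that value; the term with the small exponent then brings it from 1
  to 0 in finite time (lemma \<open>fixed_time_lyapunov\<close>).  Both times add up to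
  \<open>1 / (\<alpha>\<^sub>i (1-p)) + 1 / (\<beta>\<^sub>i (q-1))\<close>, which is below the asserted bound for every \<open>i\<close>.
\<close>

section \<open>Fixed-time convergence of scalar Lyapunov functions\<close>

lemma derivative_le_imp_increment_le:
  fixes f :: "real \<Rightarrow> real"
  assumes "u \<le> v"
    and der: "\<And>t. u \<le> t \<Longrightarrow> t \<le> v \<Longrightarrow> (f has_real_derivative f' t) (at t within {u..v})"
    and le: "\<And>t. u \<le> t \<Longrightarrow> t \<le> v \<Longrightarrow> f' t \<le> c"
  shows "f v - f u \<le> c * (v - u)"
proof -
  have "\<exists>t\<in>{u..v}. f v - f u = f' t * (v - u)"
    using mvt_very_simple[OF \<open>u \<le> v\<close>, of f "\<lambda>t s. f' t * s"] der
    by (simp add: has_field_derivative_def)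
  then obtain t where "u \<le> t" "t \<le> v" "f v - f u = f' t * (v - u)"
    by auto
  then show ?thesis
    using le[of t] \<open>u \<le> v\<close> by (simp add: mult_right_mono)
qed

text \<open>
  While \<open>V > 0\<close>, a power of \<open>V\<close> linearises either term of the differential inequality:
  \<open>V\<^bsup>1-\<nu>\<^esup>\<close> grows at rate at least \<open>B (\<nu> - 1)\<close>, and it starts positive, so it exceeds 1 at time
  \<open>1 / (B (\<nu> - 1))\<close> whatever \<open>V 0\<close> was; as its exponent is negative, this means \<open>V < 1\<close>.
  Similarly \<open>V\<^bsup>1-\<mu>\<^esup>\<close> falls at rate at least \<open>A (1 - \<mu>)\<close>, so starting below 1 it would be negative
  after a further \<open>1 / (A (1 - \<mu>))\<close>.
\<close>
lemma fixed_time_lyapunov: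
  fixes V :: "real \<Rightarrow> real"
  assumes nonneg: "\<And>t. 0 \<le> t \<Longrightarrow> 0 \<le> V t"
    and der: "\<And>t. 0 \<le> t \<Longrightarrow> (V has_real_derivative V' t) (at t within {0..})"
    and decay: "\<And>t. 0 \<le> t \<Longrightarrow> V' t \<le> - A * V t powr \<mu> - B * V t powr \<nu>"
    and A: "0 < A" and B: "0 < B" and \<mu>: "\<mu> < 1" and \<nu>: "1 < \<nu>"
    and t: "1 / (A * (1 - \<mu>)) + 1 / (B * (\<nu> - 1)) \<le> t"
  shows "V t = 0"
proof (rule ccontr)
  assume "V t \<noteq> 0"
  define t1 where "t1 = 1 / (B * (\<nu> - 1))"
  have pos_rates: "0 < A * (1 - \<mu>)" "0 < B * (\<nu> - 1)"
    using A B \<mu> \<nu> by simp_all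
  have "0 < t1"
    using pos_rates by (simp add: t1_def)
  have t1_t: "1 / (A * (1 - \<mu>)) \<le> t - t1"
    using t by (simp add: t1_def)
  then have "t1 \<le> t"
    using pos_rates by (smt (verit) divide_nonneg_pos)
  have der_within: "(V has_real_derivative V' s) (at s within {u..v})" if "0 \<le> u" "u \<le> s" for s u v
    using der[of s] that by (auto intro: DERIV_subset)
  \<comment> \<open>As \<open>V\<close> never increases, its positivity at \<open>t\<close> propagates back to all earlier times.\<close>
  have V_pos: "0 < V s" if "0 \<le> s" "s \<le> t" for s
  proof -
    have "V' r \<le> 0" if "0 \<le> r" for r
      using decay[OF that] A B
      by (smt (verit) mult_nonneg_nonneg mult_minus_left powr_ge_zero)
    then have "V t - V s \<le> 0 * (t - s)"
      using that by (intro derivative_le_imp_increment_le[where f' = V'] der_within) auto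
    then show ?thesis
      using nonneg[of t] \<open>V t \<noteq> 0\<close> that by simp
  qed
  have powr_der: "((\<lambda>s. V s powr e) has_real_derivative e * V s powr (e - 1) * V' s) (at s within {u..v})"
    if "0 \<le> u" "u \<le> s" "s \<le> t" for e s u v
    using that by (intro DERIV_chain2[of "\<lambda>z. z powr e"] has_real_derivative_powr der_within V_pos) auto
  have "- (V t1 powr (1 - \<nu>)) - - (V 0 powr (1 - \<nu>)) \<le> - (B * (\<nu> - 1)) * (t1 - 0)"
  proof (rule derivative_le_imp_increment_le)
    fix s assume s: "0 \<le> s" "s \<le> t1"
    show "((\<lambda>s. - (V s powr (1 - \<nu>))) has_real_derivative
        (\<nu> - 1) * V s powr (- \<nu>) * V' s) (at s within {0..t1})"
      using DERIV_minus[OF powr_der[of 0 s "1 - \<nu>" t1]] s \<open>t1 \<le> t\<close>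
      by (simp add: algebra_simps)
    have Vs: "0 < V s"
      using s \<open>t1 \<le> t\<close> V_pos by simp
    have "V' s \<le> - B * V s powr \<nu>"
      using decay[OF s(1)] A by (smt (verit) mult_nonneg_nonneg mult_minus_left powr_ge_zero)
    then have "(\<nu> - 1) * V s powr (- \<nu>) * V' s \<le> (\<nu> - 1) * V s powr (- \<nu>) * (- B * V s powr \<nu>)"
      using \<nu> by (intro mult_left_mono) auto
    also have "\<dots> = - (B * (\<nu> - 1))"
      using Vs by (simp add: powr_minus field_simps)
    finally show "(\<nu> - 1) * V s powr (- \<nu>) * V' s \<le> - (B * (\<nu> - 1))" .
  qed (use \<open>0 < t1\<close> in simp)
  moreover have "B * (\<nu> - 1) * t1 = 1"
    using B \<nu> by (simp add: t1_def)
  moreover have "0 < V 0 powr (1 - \<nu>)"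
    using V_pos[of 0] \<open>0 < t1\<close> \<open>t1 \<le> t\<close> by simp
  ultimately have "1 < V t1 powr (1 - \<nu>)"
    unfolding mult_minus_left diff_0_right by linarith
  then have "V t1 < 1"
    using \<nu> V_pos[of t1] \<open>0 < t1\<close> \<open>t1 \<le> t\<close>
    by (smt (verit) powr_mono2' powr_one_eq_one)
  then have "V t1 powr (1 - \<mu>) < 1"
    using \<mu> V_pos[of t1] \<open>0 < t1\<close> \<open>t1 \<le> t\<close>
    by (smt (verit) powr_less_mono2 powr_one_eq_one)
  moreover have "V t powr (1 - \<mu>) - V t1 powr (1 - \<mu>) \<le> - (A * (1 - \<mu>)) * (t - t1)"
  proof (rule derivative_le_imp_increment_le)
    fix s assume s: "t1 \<le> s" "s \<le> t"
    show "((\<lambda>s. V s powr (1 - \<mu>)) has_real_derivative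
        (1 - \<mu>) * V s powr (- \<mu>) * V' s) (at s within {t1..t})"
      using powr_der[of t1 s "1 - \<mu>" t] s \<open>0 < t1\<close> by simp
    have Vs: "0 < V s"
      using s \<open>0 < t1\<close> V_pos by simp
    have "V' s \<le> - A * V s powr \<mu>"
      using decay[of s] s \<open>0 < t1\<close> B
      by (smt (verit) mult_nonneg_nonneg mult_minus_left powr_ge_zero)
    then have "(1 - \<mu>) * V s powr (- \<mu>) * V' s \<le> (1 - \<mu>) * V s powr (- \<mu>) * (- A * V s powr \<mu>)"
      using \<mu> by (intro mult_left_mono) auto
    also have "\<dots> = - (A * (1 - \<mu>))"
      using Vs by (simp add: powr_minus field_simps)
    finally show "(1 - \<mu>) * V s powr (- \<mu>) * V' s \<le> - (A * (1 - \<mu>))" .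
  qed (fact \<open>t1 \<le> t\<close>)
  moreover have "1 \<le> A * (1 - \<mu>) * (t - t1)"
    using t1_t pos_rates(1) by (simp only: pos_divide_le_eq mult.commute)
  ultimately have "V t powr (1 - \<mu>) < 0"
    unfolding mult_minus_left by linarith
  then show False
    by (smt (verit) powr_ge_zero)
qed

text \<open>
  The Lyapunov function \<open>s\<^sup>2\<close> is used rather than \<open>|s|\<close> because it is differentiable where the
  solution vanishes; its exponents are \<open>(1 + p) / 2\<close> and \<open>(1 + q) / 2\<close>.
\<close>
lemma fixed_time_scalar:
  fixes s :: "real \<Rightarrow> real"
  assumes der: "\<And>t. 0 \<le> t \<Longrightarrow> (s has_real_derivative
      - (a * sgn (s t) * \<bar>s t\<bar> powr p + b * sgn (s t) * \<bar>s t\<bar> powr q)) (at t within {0..})"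
    and "0 < a" "0 < b" "p < 1" "1 < q"
    and t: "1 / (a * (1 - p)) + 1 / (b * (q - 1)) \<le> t"
  shows "s t = 0"
proof -
  have square_powr: "r * (sgn r * \<bar>r\<bar> powr e) = (r\<^sup>2) powr ((1 + e) / 2)" for r e :: real
  proof (cases "r = 0")
    case False
    have "r\<^sup>2 = \<bar>r\<bar> powr 2"
      by simp
    then have "(r\<^sup>2) powr ((1 + e) / 2) = \<bar>r\<bar> powr (1 + e)"
      by (simp only: powr_powr) (simp add: add_divide_distrib)
    also have "\<dots> = \<bar>r\<bar> * \<bar>r\<bar> powr e"
      using False by (simp add: powr_add)
    finally show ?thesis
      by (simp add: abs_sgn[of r] ac_simps)
  qed simp
  have "(s t)\<^sup>2 = 0"
  proof (rule fixed_time_lyapunov[where V = "\<lambda>t. (s t)\<^sup>2" and A = "2 * a" and B = "2 * b"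
        and \<mu> = "(1 + p) / 2" and \<nu> = "(1 + q) / 2"])
    fix r :: real assume "0 \<le> r"
    show "((\<lambda>t. (s t)\<^sup>2) has_real_derivative
        - (2 * a) * (s r)\<^sup>2 powr ((1 + p) / 2) - 2 * b * (s r)\<^sup>2 powr ((1 + q) / 2)) (at r within {0..})"
      unfolding square_powr[symmetric]
      using DERIV_power[OF der[OF \<open>0 \<le> r\<close>], of 2] by (simp add: algebra_simps)
  next
    show "1 / (2 * a * (1 - (1 + p) / 2)) + 1 / (2 * b * ((1 + q) / 2 - 1)) \<le> t"
    proof -
      have "2 * a * (1 - (1 + p) / 2) = a * (1 - p)" "2 * b * ((1 + q) / 2 - 1) = b * (q - 1)"
        by (simp_all add: field_simps)
      then show ?thesis
        using t by (simp only:)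
    qed
  qed (use assms in auto)
  then show ?thesis
    by simp
qed

section \<open>Closed-loop dynamics of the constraint\<close>

text \<open>
  \<open>A A\<^sup>T\<close> has trivial kernel: \<open>A A\<^sup>T y = 0\<close> gives \<open>|A\<^sup>T y|\<^sup>2 = \<langle>y, A A\<^sup>T y\<rangle> = 0\<close>, and
  \<open>A\<^sup>T\<close> is injective when \<open>A\<close> has full row rank.
\<close>
lemma invertible_mult_transpose:
  fixes A :: "real ^ 'n ^ 'm"
  assumes "rank A = CARD('m)"
  shows "invertible (A ** transpose A)"
proof -
  have inj: "inj ((*v) (transpose A))"
    using assms full_rank_injective[of "transpose A"] by (simp add: rank_transpose)
  have "y = 0" if "(A ** transpose A) *v y = 0" for y
  proof -
    have "(transpose A *v y) \<bullet> (transpose A *v y) = y \<bullet> ((A ** transpose A) *v y)"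
      by (simp add: dot_lmul_matrix[symmetric] matrix_vector_mul_assoc[symmetric])
    then have "transpose A *v y = transpose A *v 0"
      using that by simp
    then show "y = 0"
      using inj by (metis injD)
  qed
  then show ?thesis
    by (simp add: invertible_left_inverse matrix_left_invertible_ker)
qed

lemma matrix_inv_right:
  fixes A :: "'a::semiring_1 ^ 'n ^ 'm"
  assumes "invertible A"
  shows "A ** matrix_inv A = mat 1"
  using someI_ex[OF assms[unfolded invertible_def]] by (simp add: matrix_inv_def)

lemma Ck_imp_differentiable: "Ck k f \<Longrightarrow> 0 < k \<Longrightarrow> f differentiable (at x)"
  by (cases k) auto

lemma constraint_dynamics:
  fixes h :: "real ^ 'n \<Rightarrow> real ^ 'm"
  assumes h: "\<And>y. h differentiable (at y)"
    and rank: "\<And>y. rank (Jac h y) = CARD('m)"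
    and traj: "trajectory \<phi> h \<alpha> \<beta> p q x"
    and "0 \<le> t"
  shows "((\<lambda>t. h (x t) $ i) has_real_derivative
      - (\<alpha> $ i * sgn (h (x t) $ i) * \<bar>h (x t) $ i\<bar> powr p
         + \<beta> $ i * sgn (h (x t) $ i) * \<bar>h (x t) $ i\<bar> powr q)) (at t within {0..})"
proof -
  define J where "J = Jac h (x t)"
  define u where "u = (\<chi> i. \<alpha> $ i * sgn (h (x t) $ i) * \<bar>h (x t) $ i\<bar> powr p
         + \<beta> $ i * sgn (h (x t) $ i) * \<bar>h (x t) $ i\<bar> powr q)"
  define g where "g = gradient \<phi> (x t)"
  define v where "v = - g - transpose J *v lambda_FxTS \<phi> h \<alpha> \<beta> p q (x t)"
  have Gram_inv: "(J ** transpose J) *v (matrix_inv (J ** transpose J) *v w) = w" for w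
    using invertible_mult_transpose[OF rank[of "x t"]]
    by (simp add: J_def matrix_vector_mul_assoc matrix_inv_right)
  have lam: "lambda_FxTS \<phi> h \<alpha> \<beta> p q (x t) =
      - (matrix_inv (J ** transpose J) *v (J *v g)) + matrix_inv (J ** transpose J) *v u"
    by (simp add: lambda_FxTS_def lambda_eq_def lambda_sw_def Gram_def J_def g_def u_def)
  have "J *v v = - (J *v g) - (J ** transpose J) *v lambda_FxTS \<phi> h \<alpha> \<beta> p q (x t)"
    by (simp add: v_def matrix_vector_mult_diff_distrib matrix_vector_mul_assoc
        linear_neg[OF matrix_vector_mul_linear] del: transpose_matrix_vector)
  also have "(J ** transpose J) *v lambda_FxTS \<phi> h \<alpha> \<beta> p q (x t) = - (J *v g) + u"
    by (simp only: lam matrix_vector_right_distrib Gram_inv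
        linear_neg[OF matrix_vector_mul_linear])
  finally have Jv: "J *v v = - u"
    by simp
  have "(x has_vector_derivative v) (at t within {0..})"
    using traj \<open>0 \<le> t\<close> by (simp add: trajectory_def v_def J_def g_def)
  moreover have "(h has_derivative (\<lambda>w. J *v w)) (at (x t))"
    using h jacobian_works unfolding J_def by blast
  ultimately have "((\<lambda>t. h (x t)) has_derivative (\<lambda>r. J *v (r *\<^sub>R v))) (at t within {0..})"
    unfolding has_vector_derivative_def
    using has_derivative_compose by fastforce
  then have "((\<lambda>t. h (x t) $ i) has_derivative (\<lambda>r. (J *v (r *\<^sub>R v)) $ i)) (at t within {0..})"
    by (rule bounded_linear.has_derivative[OF bounded_linear_vec_nth])
  moreover have "(\<lambda>r. (J *v (r *\<^sub>R v)) $ i) = (*) (- u $ i)"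
    by (simp add: matrix_vector_mult_scaleR Jv fun_eq_iff)
  ultimately show ?thesis
    by (simp add: has_field_derivative_def u_def)
qed

theorem theorem1:
  fixes \<phi> :: "real ^ 'n \<Rightarrow> real"
    and h :: "real ^ 'n \<Rightarrow> real ^ 'm"
    and \<alpha> \<beta> :: "real ^ 'm"
    and p q :: real
  assumes "Ck CARD('n) \<phi>"
    and "Ck CARD('n) h"
    and "\<And>x. rank (Jac h x) = CARD('m)"
    and "\<And>i. \<alpha> $ i > 0"
    and "\<And>i. \<beta> $ i > 0"
    and "0 < p" and "p < 1"
    and "q > 1"
  shows "\<exists>Tc>0.
           Tc \<le> 2 / (Min (range (\<lambda>i. \<alpha> $ i)) * (1 - p)) + 2 / (Min (range (\<lambda>i. \<beta> $ i)) * (q - 1)) \<and>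
           (\<forall>x. trajectory \<phi> h \<alpha> \<beta> p q x \<longrightarrow> (\<forall>t\<ge>Tc. h (x t) = 0))"
proof -
  define a where "a = Min (range (\<lambda>i. \<alpha> $ i))"
  define b where "b = Min (range (\<lambda>i. \<beta> $ i))"
  have a: "0 < a" "a \<le> \<alpha> $ i" and b: "0 < b" "b \<le> \<beta> $ i" for i
    using assms(4,5) by (simp_all add: a_def b_def)
  define T where "T = 2 / (a * (1 - p)) + 2 / (b * (q - 1))"
  have "0 < T"
    using a b \<open>p < 1\<close> \<open>q > 1\<close> by (simp add: T_def add_pos_pos)
  moreover have "h (x t) = 0" if traj: "trajectory \<phi> h \<alpha> \<beta> p q x" and "T \<le> t" for x t
  proof -
    have "h (x t) $ i = 0" for i
    proof (rule fixed_time_scalar[where s = "\<lambda>t. h (x t) $ i" and a = "\<alpha> $ i" and b = "\<beta> $ i"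
          and p = p and q = q])
      show "((\<lambda>t. h (x t) $ i) has_real_derivative
          - (\<alpha> $ i * sgn (h (x t) $ i) * \<bar>h (x t) $ i\<bar> powr p
             + \<beta> $ i * sgn (h (x t) $ i) * \<bar>h (x t) $ i\<bar> powr q)) (at t within {0..})"
        if "0 \<le> t" for t
        using constraint_dynamics[OF _ assms(3) traj that] Ck_imp_differentiable[OF assms(2)]
        by simp
      have "1 / (\<alpha> $ i * (1 - p)) \<le> 2 / (a * (1 - p))" "1 / (\<beta> $ i * (q - 1)) \<le> 2 / (b * (q - 1))"
        using a b \<open>p < 1\<close> \<open>q > 1\<close> by (intro frac_le mult_right_mono; simp)+
      then show "1 / (\<alpha> $ i * (1 - p)) + 1 / (\<beta> $ i * (q - 1)) \<le> t"
        using \<open>T \<le> t\<close> by (simp add: T_def)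
    qed (use assms in auto)
    then show ?thesis
      by (simp add: vec_eq_iff)
  qed
  ultimately show ?thesis
    unfolding T_def a_def b_def by blast
qed

end
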